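(* Let $T$ be a fixed positive integer. Assume that there exist two positive constants $c$ and $d$ such that $$d^{3}<\left(\frac{3}{(T+2)(T+4)(2T+2)^{T+3}}\right)c^{T+4}<\frac{3}{(T+2)(T+4)}.$$ Let $g:\mathbb{R}\to\mathbb{R}$ be a non-negative continuous function such that $\int_0^t g(s)\,ds<c_0(1+t^2)$ for every $t\in\mathbb{R}$ and some $c_0>0$, and $$\frac{\int_0^c g(\xi)\,d\xi}{c^{T+4}}<\left(\frac{3}{(T+4)(T+2)(2T+2)^{T+3}}\right)\frac{\int_0^d g(\xi)\,d\xi}{d^{3}}.$$ Then, for each $$\lambda\in\left]\frac{d^{3}(T+2)}{3T\int_0^d g(\xi)\,d\xi},\ \frac{3c^{T+4}-d^{3}(T+4)(T+2)(2T+2)^{T+3}}{3T(T+4)(2T+2)^{T+3}\int_d^c g(\xi)\,d\xi}\right[,$$ the problem $$\begin{cases}-\Delta\big(|\Delta u(k-1)|^{k}\Delta u(k-1)\big)+|u(k)|^{k+1}u(k)=\lambda g(u(k)), & k\in[1,T],\\ u(0)=u(T+1)=0,\end{cases}$$ admits at least one positive solution in the space $\{u:[0,T+1]\to\mathbb{R} : u(0)=u(T+1)=0\}$.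
   Context: Intervals such as $[1,T]$ and $[0,T+1]$ on which $u$ is defined are discrete: $[a,b]=\{a,a+1,\dots,b\}$. $\Delta u(k)=u(k+1)-u(k)$ is the forward difference operator; the outer $\Delta$ acts on the function $k\mapsto |\Delta u(k-1)|^{k}\Delta u(k-1)$, i.e. $\Delta\big(|\Delta u(k-1)|^{k}\Delta u(k-1)\big)=|\Delta u(k)|^{k+1}\Delta u(k)-|\Delta u(k-1)|^{k}\Delta u(k-1)$. $]a,b[$ denotes an open real interval. A positive solution is a solution $u$ with $u(k)>0$ for all $k\in[1,T]$. A quotient with positive numerator and zero denominator is read as $+\infty$. *)

theory Defs
  imports "HOL-Analysis.Analysis"
begin

definition fwd_diff :: "(nat \<Rightarrow> real) \<Rightarrow> nat \<Rightarrow> real" where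
  "fwd_diff u k = u (k + 1) - u k"

text \<open>Functions on the discrete interval \<open>{0..T+1}\<close> are extensional, so that they are
  determined by their values there.\<close>

definition dirichlet_space :: "nat \<Rightarrow> (nat \<Rightarrow> real) set" where
  "dirichlet_space T = {u \<in> {0..T+1} \<rightarrow>\<^sub>E UNIV. u 0 = 0 \<and> u (T + 1) = 0}"

text \<open>The subtraction \<open>k - 1\<close> on natural numbers never truncates: for \<open>k \<in> {1..T}\<close> the
  outer difference evaluates its argument only at \<open>k\<close> and \<open>k + 1\<close>.\<close>

definition is_solution :: "nat \<Rightarrow> (real \<Rightarrow> real) \<Rightarrow> real \<Rightarrow> (nat \<Rightarrow> real) \<Rightarrow> bool" where
  "is_solution T g lam u \<longleftrightarrow>
     u \<in> dirichlet_space T \<and>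
     (\<forall>k\<in>{1..T}.
        - fwd_diff (\<lambda>j. \<bar>fwd_diff u (j - 1)\<bar> ^ j * fwd_diff u (j - 1)) k
        + \<bar>u k\<bar> ^ (k + 1) * u k = lam * g (u k))"

definition is_positive_solution :: "nat \<Rightarrow> (real \<Rightarrow> real) \<Rightarrow> real \<Rightarrow> (nat \<Rightarrow> real) \<Rightarrow> bool" where
  "is_positive_solution T g lam u \<longleftrightarrow> is_solution T g lam u \<and> (\<forall>k\<in>{1..T}. u k > 0)"

text \<open>End points of the parameter interval. They live in \<^typ>\<open>ereal\<close> because the denominator
  of the upper one may vanish: division of a positive number by zero yields \<open>\<infinity>\<close> there,
  which is the intended reading.\<close>

definition lambda_lower :: "nat \<Rightarrow> (real \<Rightarrow> real) \<Rightarrow> real \<Rightarrow> ereal" where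
  "lambda_lower T g d =
     ereal (d ^ 3 * (real T + 2)) / ereal (3 * real T * (LBINT \<xi>=0..ereal d. g \<xi>))"

definition lambda_upper :: "nat \<Rightarrow> (real \<Rightarrow> real) \<Rightarrow> real \<Rightarrow> real \<Rightarrow> ereal" where
  "lambda_upper T g c d =
     ereal (3 * c ^ (T + 4) - d ^ 3 * (real T + 4) * (real T + 2) * (2 * real T + 2) ^ (T + 3))
     / ereal (3 * real T * (real T + 4) * (2 * real T + 2) ^ (T + 3)
              * (LBINT \<xi>=ereal d..ereal c. g \<xi>))"

end

theory Submission
  imports Defs
begin

text \<open>The equation is the Euler-Lagrange equation of the energy
  \<open>\<Sum>|\<Delta>u(j-1)|^(j+2)/(j+2) + \<Sum>(|u(j)|^(j+3)/(j+3) - \<lambda> G(u(j)))\<close>, where \<open>G\<close> is the primitive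
  of \<open>g\<close> vanishing at \<open>0\<close>. All exponents are at least \<open>3\<close> while \<open>G\<close> grows at most quadratically,
  so the energy is coercive and attains its minimum. The lower bound on \<open>\<lambda>\<close> makes the energy
  negative at the constant function \<open>d\<close> (on \<open>{1..T}\<close>), hence the minimizer is not \<open>0\<close>; by the
  discrete strong maximum principle a nonzero solution is positive.\<close>

section \<open>Differentiation of the energy\<close>

lemma has_real_derivative_abs_power:
  "((\<lambda>x::real. \<bar>x\<bar> ^ (n + 2) / (real n + 2)) has_real_derivative \<bar>x\<bar> ^ n * x) (at x)"
proof (cases "x = 0")
  case False
  have "(abs has_real_derivative sgn x) (at x)"
  proof (cases "x > 0")
    case True
    have "((\<lambda>x. x) has_real_derivative sgn x) (at x)"
      using True by simp
    then show ?thesis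
      by (rule has_field_derivative_transform_within_open[of _ _ _ "{0<..}"]) (use True in auto)
  next
    case nonpos: False
    have "(uminus has_real_derivative sgn x) (at x)"
      using False nonpos by (auto intro!: derivative_eq_intros)
    then show ?thesis
      by (rule has_field_derivative_transform_within_open[of _ _ _ "{..<0}"]) (use False nonpos in auto)
  qed
  note deriv = DERIV_cdivide[OF DERIV_power[OF this, of "n + 2"], of "real n + 2"]
  have "sgn x * \<bar>x\<bar> ^ (n + 1) = \<bar>x\<bar> ^ n * (sgn x * \<bar>x\<bar>)"
    by simp
  also have "\<dots> = \<bar>x\<bar> ^ n * x"
    by (simp only: sgn_mult_abs)
  finally have "sgn x * \<bar>x\<bar> ^ (n + 1) = \<bar>x\<bar> ^ n * x" .
  with deriv show ?thesis
    by (elim DERIV_cong) (simp add: add.commute[of 2 "real n"] del: power_Suc)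
next
  case True
  \<comment> \<open>The absolute value has no derivative at 0, so the chain rule gives way to the
    difference quotient. It simplifies to \<open>|h|^n * h / (n + 2)\<close>, whose factor
    \<open>h\<close> forces the limit 0 even for \<open>n = 0\<close>.\<close>
  have "((\<lambda>h::real. \<bar>h\<bar> ^ n * h / (real n + 2)) \<longlongrightarrow> \<bar>0\<bar> ^ n * 0 / (real n + 2)) (at 0)"
    by (intro tendsto_intros) simp
  moreover have "\<bar>h\<bar> ^ n * h / (real n + 2) = \<bar>h\<bar> ^ (n + 2) / (real n + 2) / h" for h :: real
    unfolding power_add power2_abs by (simp add: power2_eq_square)
  ultimately have "((\<lambda>h::real. \<bar>h\<bar> ^ (n + 2) / (real n + 2) / h) \<longlongrightarrow> 0) (at 0)"
    by simp
  with True show ?thesis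
    by (simp add: DERIV_def)
qed

text \<open>\<open>F\<close> will be \<open>lam\<close> times the primitive of \<open>g\<close>.
  Both boundary edges count, hence \<open>T+1\<close> differences but only \<open>T\<close>
  zero-order terms. The powers are those whose derivatives are \<open>|x|^j * x\<close> and
  \<open>|x|^(j+1) * x\<close>, as in the equation.\<close>

definition energy :: "nat \<Rightarrow> (real \<Rightarrow> real) \<Rightarrow> (nat \<Rightarrow> real) \<Rightarrow> real" where
  "energy T F u = (\<Sum>j=1..T+1. \<bar>u j - u (j - 1)\<bar> ^ (j + 2) / (real j + 2))
     + (\<Sum>j=1..T. \<bar>u j\<bar> ^ (j + 3) / (real j + 3) - F (u j))"

text \<open>The coordinate \<open>u k\<close> enters only the differences with \<open>j = k\<close>
  and \<open>j = k + 1\<close>, with opposite signs. The contributions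
  \<open>\<phi> k - \<phi> (k + 1)\<close> form the negative outer difference.\<close>

lemma energy_partial_derivative:
  assumes k: "k \<in> {1..T}" and F: "(F has_real_derivative f (u k)) (at (u k))"
  shows "((\<lambda>t. energy T F (u(k := t))) has_real_derivative
     - fwd_diff (\<lambda>j. \<bar>fwd_diff u (j - 1)\<bar> ^ j * fwd_diff u (j - 1)) k
     + \<bar>u k\<bar> ^ (k + 1) * u k - f (u k)) (at (u k))"
proof -
  define \<phi> where "\<phi> j = \<bar>u j - u (j - 1)\<bar> ^ j * (u j - u (j - 1))" for j
  have "((\<lambda>t. \<bar>(u(k := t)) j - (u(k := t)) (j - 1)\<bar> ^ (j + 2) / (real j + 2)) has_real_derivative
      (if j = k then \<phi> j else 0) - (if j = k + 1 then \<phi> j else 0)) (at (u k))"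
    if "j \<in> {1..T+1}" for j
  proof -
    have shift: "j - 1 = k \<longleftrightarrow> j = k + 1" using that by auto
    have "((\<lambda>t. (u(k := t)) j - (u(k := t)) (j - 1)) has_real_derivative
        (if j = k then 1 else 0) - (if j = k + 1 then 1 else 0)) (at (u k))"
      unfolding fun_upd_apply shift using k
      by (cases "j = k"; cases "j = k + 1") (auto intro!: derivative_eq_intros)
    from DERIV_chain2[OF has_real_derivative_abs_power[of j] this]
    show ?thesis
      unfolding \<phi>_def by (rule DERIV_cong) auto
  qed
  then have gradient_part: "((\<lambda>t. \<Sum>j=1..T+1. \<bar>(u(k := t)) j - (u(k := t)) (j - 1)\<bar> ^ (j + 2) / (real j + 2))
      has_real_derivative
      (\<Sum>j=1..T+1. (if j = k then \<phi> j else 0) - (if j = k + 1 then \<phi> j else 0))) (at (u k))"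
    by (rule DERIV_sum)
  have "((\<lambda>t. \<bar>(u(k := t)) j\<bar> ^ (j + 3) / (real j + 3) - F ((u(k := t)) j)) has_real_derivative
      (if j = k then \<bar>u j\<bar> ^ (j + 1) * u j - f (u j) else 0)) (at (u k))" for j
    using DERIV_diff[OF has_real_derivative_abs_power[of "k + 1" "u k"] F]
    by (cases "j = k") (auto simp: add_ac numeral_3_eq_3 numeral_2_eq_2)
  then have "((\<lambda>t. \<Sum>j=1..T. \<bar>(u(k := t)) j\<bar> ^ (j + 3) / (real j + 3) - F ((u(k := t)) j))
      has_real_derivative
      (\<Sum>j=1..T. if j = k then \<bar>u j\<bar> ^ (j + 1) * u j - f (u j) else 0)) (at (u k))"
    by (intro DERIV_sum)
  from DERIV_add[OF gradient_part this] show ?thesis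
    unfolding energy_def
    by (rule DERIV_cong) (use k in \<open>auto simp: sum_subtractf fwd_diff_def \<phi>_def simp del: sum.cl_ivl_Suc\<close>)
qed

section \<open>Coercivity and existence of a minimizer\<close>

lemma energy_coordinatewise_coercive:
  assumes "\<And>t. F t \<le> C * (1 + t\<^sup>2)" "C > 0"
  obtains M where "\<And>u k. k \<in> {1..T} \<Longrightarrow> \<bar>u k\<bar> - M \<le> energy T F u"
proof -
  \<comment> \<open>Beyond \<open>R\<close> the power dominates: \<open>y > R\<close> and
    \<open>j \<le> T\<close> give \<open>y^(j+3)/(j+3) \<ge> (C+1) * y^2\<close>, which leaves
    \<open>y^2 - C \<ge> y - M\<close> after subtracting the growth bound of \<open>F\<close>. Up to
    \<open>R\<close> the constant \<open>M\<close> absorbs everything.\<close>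
  define R where "R = (C + 1) * (real T + 3)"
  define M where "M = C * R\<^sup>2 + R + C + 1"
  have "R \<ge> 1"
    unfolding R_def using mult_mono[of 1 "C + 1" 1 "real T + 3"] \<open>C > 0\<close> by simp
  have pointwise: "\<bar>x\<bar> - M \<le> \<bar>x\<bar> ^ (j + 3) / (real j + 3) - F x" if j: "j \<in> {1..T}" for x j
  proof -
    define y where "y = \<bar>x\<bar>"
    have y: "y \<ge> 0" "x\<^sup>2 = y\<^sup>2" by (simp_all add: y_def)
    have Fx: "F x \<le> C + C * y\<^sup>2"
      using assms(1)[of x] y by (simp add: distrib_left)
    show ?thesis
    proof (cases "y \<le> R")
      case True
      then have "C * y\<^sup>2 \<le> C * R\<^sup>2"
        using y \<open>C > 0\<close> by (intro mult_left_mono power_mono) auto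
      moreover have "0 \<le> y ^ (j + 3) / (real j + 3)" using y by simp
      ultimately show ?thesis
        using Fx True \<open>C > 0\<close> unfolding M_def y_def[symmetric] by linarith
    next
      case False
      then have "y \<ge> 1" using \<open>R \<ge> 1\<close> by simp
      have "(C + 1) * (real T + 3) * y\<^sup>2 \<le> y * y\<^sup>2"
        using False unfolding R_def by (intro mult_right_mono) auto
      also have "y * y\<^sup>2 = y ^ 3" by (simp add: eval_nat_numeral)
      also have "y ^ 3 \<le> y ^ (j + 3)" using \<open>y \<ge> 1\<close> by (intro power_increasing) auto
      finally have "(C + 1) * y\<^sup>2 \<le> y ^ (j + 3) / (real T + 3)"
        by (simp add: field_simps)
      also have "\<dots> \<le> y ^ (j + 3) / (real j + 3)"
        using j y by (intro divide_left_mono) auto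
      finally have "(C + 1) * y\<^sup>2 \<le> y ^ (j + 3) / (real j + 3)" .
      moreover have "y \<le> y\<^sup>2" using \<open>y \<ge> 1\<close> by (simp add: power2_eq_square)
      moreover have "C \<le> M" unfolding M_def using \<open>C > 0\<close> \<open>R \<ge> 1\<close> by simp
      ultimately show ?thesis
        using Fx unfolding y_def[symmetric] distrib_right by linarith
    qed
  qed
  have "\<bar>u k\<bar> - real T * M \<le> energy T F u" if "k \<in> {1..T}" for u k
  proof -
    have "\<bar>u k\<bar> \<le> (\<Sum>j=1..T. \<bar>u j\<bar>)"
      using that by (intro member_le_sum) auto
    then have "\<bar>u k\<bar> - real T * M \<le> (\<Sum>j=1..T. \<bar>u j\<bar> - M)"
      by (simp add: sum_subtractf)
    also have "\<dots> \<le> (\<Sum>j=1..T. \<bar>u j\<bar> ^ (j + 3) / (real j + 3) - F (u j))"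
      by (intro sum_mono pointwise)
    also have "\<dots> \<le> energy T F u"
      unfolding energy_def by (simp add: sum_nonneg)
    finally show ?thesis .
  qed
  then show ?thesis by (rule that)
qed

text \<open>Coercivity confines all competitors of the zero function \<open>z\<close> to a box,
  which is compact in the product topology by Tychonoff's theorem. The continuous energy attains its
  minimum there.\<close>

lemma energy_attains_min:
  assumes "continuous_on UNIV F" and growth: "\<And>t. F t \<le> C * (1 + t\<^sup>2)" "C > 0"
  obtains u where "u \<in> dirichlet_space T"
    and "\<And>v. v \<in> dirichlet_space T \<Longrightarrow> energy T F u \<le> energy T F v"
proof -
  obtain M where M: "\<And>u k. k \<in> {1..T} \<Longrightarrow> \<bar>u k\<bar> - M \<le> energy T F u"
    using energy_coordinatewise_coercive[OF growth] by metis
  define z :: "nat \<Rightarrow> real" where "z = restrict (\<lambda>_. 0) {0..T+1}"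
  \<comment> \<open>If \<open>|v k| > R\<close> at an interior \<open>k\<close>, then the energy of
    \<open>v\<close> is at least \<open>|v k| - M\<close>, hence exceeds that of
    \<open>z\<close>.\<close>
  define R where "R = energy T F z + M"
  \<comment> \<open>The factor \<open>{undefined}\<close> makes the members of the box extensional on \<open>{0..T+1}\<close>.\<close>
  define B :: "nat \<Rightarrow> real set" where
    "B k = (if k \<in> {1..T} then {-R..R} else if k \<in> {0, T+1} then {0} else {undefined})" for k
  define K where "K = Pi\<^sub>E UNIV B"
  have "compactin (product_topology (\<lambda>_. euclidean) UNIV) K"
    unfolding K_def by (subst compactin_PiE) (auto simp: B_def)
  then have "compact K"
    by (simp add: euclidean_product_topology)
  have coord: "continuous_on A (\<lambda>u::nat \<Rightarrow> real. u j)" for A j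
    by (rule continuous_on_subset[OF continuous_on_product_coordinates]) simp
  have "continuous_on K (energy T F)"
    unfolding energy_def
    by (intro continuous_intros coord continuous_on_compose2[OF assms(1)]) auto
  have outside: "energy T F z \<le> energy T F v" if v: "v \<in> dirichlet_space T" "v \<notin> K" for v
  proof -
    obtain k where k: "v k \<notin> B k"
      using v(2) unfolding K_def by auto
    \<comment> \<open>Boundary values and extensionality already agree with \<open>B\<close>, so
      only an interior coordinate can leave the box.\<close>
    moreover have "k \<in> {1..T}"
      using v(1) k by (auto simp: B_def dirichlet_space_def PiE_def extensional_def split: if_splits)
    ultimately have "\<bar>v k\<bar> > R"
      by (auto simp: B_def)
    then show ?thesis
      using M[OF \<open>k \<in> {1..T}\<close>, of v] unfolding R_def by simp
  qed
  \<comment> \<open>This puts 0 into \<open>{-R..R}\<close>, so the box contains \<open>z\<close>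
    and is nonempty.\<close>
  have "R \<ge> 0" if "k \<in> {1..T}" for k
    using M[OF that, of z] abs_ge_zero[of "z k"] unfolding R_def by linarith
  then have "z \<in> K"
    by (auto simp: K_def B_def z_def)
  obtain u where u: "u \<in> K" "\<And>v. v \<in> K \<Longrightarrow> energy T F u \<le> energy T F v"
    using continuous_attains_inf[OF \<open>compact K\<close> _ \<open>continuous_on K (energy T F)\<close>] \<open>z \<in> K\<close> by blast
  show ?thesis
  proof (rule that[of u])
    have B: "u k \<in> B k" for k
      using u(1) by (auto simp: K_def)
    have "u k = undefined" if "k \<notin> {0..T+1}" for k
      using B[of k] that by (auto simp: B_def split: if_splits)
    with B[of 0] B[of "T + 1"] show "u \<in> dirichlet_space T"
      by (auto simp: dirichlet_space_def PiE_def extensional_def B_def)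
  next
    fix v assume "v \<in> dirichlet_space T"
    then show "energy T F u \<le> energy T F v"
      using u(2) outside[of v] \<open>z \<in> K\<close> by (cases "v \<in> K") (auto intro: order_trans)
  qed
qed

section \<open>Minimizers solve the equation, and nonzero solutions are positive\<close>

lemma energy_minimizer_is_solution:
  assumes u: "u \<in> dirichlet_space T"
    and min: "\<And>v. v \<in> dirichlet_space T \<Longrightarrow> energy T F u \<le> energy T F v"
    and F: "\<And>t. (F has_real_derivative lam * g t) (at t)"
  shows "is_solution T g lam u"
proof -
  have "- fwd_diff (\<lambda>j. \<bar>fwd_diff u (j - 1)\<bar> ^ j * fwd_diff u (j - 1)) k
      + \<bar>u k\<bar> ^ (k + 1) * u k - lam * g (u k) = 0" if k: "k \<in> {1..T}" for k
  proof (rule DERIV_local_min)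
    show "((\<lambda>t. energy T F (u(k := t))) has_real_derivative
        - fwd_diff (\<lambda>j. \<bar>fwd_diff u (j - 1)\<bar> ^ j * fwd_diff u (j - 1)) k
        + \<bar>u k\<bar> ^ (k + 1) * u k - lam * g (u k)) (at (u k))"
      by (rule energy_partial_derivative[OF k, where f = "\<lambda>t. lam * g t", OF F])
    \<comment> \<open>Changing one interior value stays in the space, so the energy along this
      coordinate has a minimum at \<open>u k\<close>.\<close>
    have "u(k := t) \<in> dirichlet_space T" for t
      using u k by (auto simp: dirichlet_space_def PiE_def extensional_def)
    then show "\<forall>t. \<bar>u k - t\<bar> < 1 \<longrightarrow> energy T F (u(k := u k)) \<le> energy T F (u(k := t))"
      using min by simp
  qed simp
  then show ?thesis
    using u by (auto simp: is_solution_def)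
qed

text \<open>Discrete strong maximum principle: a nonpositive interior value forces the global
  minimum to be 0, and a zero at an interior point spreads to both neighbours.\<close>

lemma solution_positive_or_zero:
  assumes sol: "is_solution T g lam u" and nonneg: "\<And>t. g t \<ge> 0" "lam \<ge> 0"
  shows "is_positive_solution T g lam u \<or> (\<forall>k\<in>{0..T+1}. u k = 0)"
proof (cases "\<forall>k\<in>{1..T}. u k > 0")
  case True
  with sol show ?thesis by (simp add: is_positive_solution_def)
next
  case False
  have bc: "u 0 = 0" "u (T + 1) = 0"
    using sol by (auto simp: is_solution_def dirichlet_space_def)
  \<comment> \<open>At such a minimum the equation reads
    \<open>- a^(k+2) - b^(k+1) - |u k|^(k+2) = lam * g (u k)\<close>. The left side is at most 0 and
    the right side at least 0, so each power vanishes.\<close>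
  have min_step: "u k = 0 \<and> u (k - 1) = 0 \<and> u (k + 1) = 0"
    if k: "k \<in> {1..T}" "u k \<le> 0" and min: "\<And>j. j \<in> {0..T+1} \<Longrightarrow> u k \<le> u j" for k
  proof -
    define a where "a = u (k + 1) - u k"
    define b where "b = u (k - 1) - u k"
    have ab: "a \<ge> 0" "b \<ge> 0"
      using min[of "k + 1"] min[of "k - 1"] k by (auto simp: a_def b_def)
    have "- fwd_diff (\<lambda>j. \<bar>fwd_diff u (j - 1)\<bar> ^ j * fwd_diff u (j - 1)) k
        + \<bar>u k\<bar> ^ (k + 1) * u k = lam * g (u k)"
      using sol k unfolding is_solution_def by blast
    moreover have "- fwd_diff (\<lambda>j. \<bar>fwd_diff u (j - 1)\<bar> ^ j * fwd_diff u (j - 1)) k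
        = - (a ^ (k + 2)) - b ^ (k + 1)"
    proof -
      have "fwd_diff u (k - 1) = - b" "fwd_diff u k = a"
        using k by (auto simp: fwd_diff_def a_def b_def)
      then show ?thesis
        using ab by (simp add: fwd_diff_def[of "\<lambda>j. _ j"])
    qed
    moreover have "\<bar>u k\<bar> ^ (k + 1) * u k = - (\<bar>u k\<bar> ^ (k + 2))"
      using k by simp
    moreover have "lam * g (u k) \<ge> 0"
      using nonneg by simp
    moreover have "a ^ (k + 2) \<ge> 0" "b ^ (k + 1) \<ge> 0" "\<bar>u k\<bar> ^ (k + 2) \<ge> 0"
      using ab by auto
    ultimately have "a ^ (k + 2) = 0" "b ^ (k + 1) = 0" "\<bar>u k\<bar> ^ (k + 2) = 0"
      by linarith+
    then show ?thesis
      by (auto simp: a_def b_def)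
  qed
  have "\<exists>m\<in>{0..T+1}. \<forall>j\<in>{0..T+1}. u m \<le> u j"
  proof -
    have "Min (u ` {0..T+1}) \<in> u ` {0..T+1}" by (rule Min_in) auto
    then obtain m where "m \<in> {0..T+1}" "u m = Min (u ` {0..T+1})" by (metis imageE)
    then show ?thesis by (metis Min_le finite_atLeastAtMost finite_imageI image_eqI)
  qed
  then obtain m where m: "m \<in> {0..T+1}" "\<And>j. j \<in> {0..T+1} \<Longrightarrow> u m \<le> u j" by blast
  obtain i where i: "i \<in> {1..T}" "u i \<le> 0" using False by force
  have "u m = 0"
  proof (cases "m \<in> {1..T}")
    case True
    moreover have "u m \<le> 0" using m(2)[of i] i by simp
    ultimately show ?thesis using min_step m(2) by blast
  next
    case False
    then have "m = 0 \<or> m = T + 1" using m(1) by auto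
    then show ?thesis using bc by auto
  qed
  \<comment> \<open>Since the global minimum is 0, every interior zero is itself a minimum
    point.\<close>
  have neighbours: "u (k - 1) = 0 \<and> u (k + 1) = 0" if "k \<in> {1..T}" "u k = 0" for k
    using min_step[of k] m(2) that \<open>u m = 0\<close> by simp
  have "u i = 0" using m(2)[of i] i \<open>u m = 0\<close> by simp
  \<comment> \<open>Starting at \<open>i\<close>, the zero propagates right to \<open>T+1\<close>,
    then left to 0.\<close>
  have up: "u k = 0" if "i \<le> k" "k \<le> T + 1" for k
    using that
  proof (induction k rule: dec_induct)
    case base
    show ?case by fact
  next
    case (step n)
    then show ?case using neighbours[of n] i by simp
  qed
  have down: "u k = 0" if "k \<le> i" for k
    using that
  proof (induction k rule: inc_induct)
    case base
    show ?case by fact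
  next
    case (step n)
    then show ?case using neighbours[of "Suc n"] i by simp
  qed
  show ?thesis
    using up down by (meson atLeastAtMost_iff nle_le)
qed

section \<open>The plateau test function and the conclusion\<close>

lemma energy_plateau_le:
  assumes "T > 0" "0 < d" "d < 1"
  shows "energy T F (\<lambda>k\<in>{0..T+1}. if k \<in> {1..T} then d else 0)
     \<le> d ^ 3 * (real T + 2) / 3 - real T * F d"
proof -
  define v :: "nat \<Rightarrow> real" where "v = (\<lambda>k\<in>{0..T+1}. if k \<in> {1..T} then d else 0)"
  \<comment> \<open>As \<open>d < 1\<close>, every term is at most the one with exponent 3. Two end
    jumps and \<open>T\<close> zero-order terms then produce the factor \<open>T + 2\<close> of
    \<open>lambda_lower\<close>.\<close>
  have pow: "d ^ (n + 3) / (real n + 3) \<le> d ^ 3 / 3" for n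
    using assms by (intro frac_le power_decreasing) auto
  have "\<bar>v j - v (j - 1)\<bar> ^ (j + 2) / (real j + 2)
      \<le> (if j = 1 then d ^ 3 / 3 else 0) + (if j = T + 1 then d ^ 3 / 3 else 0)"
    if "j \<in> {1..T+1}" for j
    using that pow[of T] assms
    by (auto simp: v_def numeral_3_eq_3 numeral_2_eq_2 add.commute[of 3 "real T"])
  then have "(\<Sum>j=1..T+1. \<bar>v j - v (j - 1)\<bar> ^ (j + 2) / (real j + 2))
      \<le> (\<Sum>j=1..T+1. (if j = 1 then d ^ 3 / 3 else 0) + (if j = T + 1 then d ^ 3 / 3 else 0))"
    by (rule sum_mono)
  also have "\<dots> = 2 * (d ^ 3 / 3)"
    unfolding sum.distrib by (simp add: sum.delta)
  finally have gradient_part: "(\<Sum>j=1..T+1. \<bar>v j - v (j - 1)\<bar> ^ (j + 2) / (real j + 2)) \<le> 2 * (d ^ 3 / 3)" .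
  have "(\<Sum>j=1..T. \<bar>v j\<bar> ^ (j + 3) / (real j + 3) - F (v j)) \<le> (\<Sum>j=1..T. d ^ 3 / 3 - F d)"
    using pow assms by (intro sum_mono) (simp add: v_def)
  also have "\<dots> = real T * (d ^ 3 / 3) - real T * F d"
    by (simp add: right_diff_distrib)
  finally have "energy T F v \<le> 2 * (d ^ 3 / 3) + (real T * (d ^ 3 / 3) - real T * F d)"
    using gradient_part unfolding energy_def by linarith
  also have "\<dots> = d ^ 3 * (real T + 2) / 3 - real T * F d"
    by (simp add: field_simps)
  finally show ?thesis
    unfolding v_def .
qed

lemma has_real_derivative_interval_integral:
  fixes g :: "real \<Rightarrow> real"
  assumes "continuous_on UNIV g"
  shows "((\<lambda>t. LBINT s=0..ereal t. g s) has_real_derivative g t) (at t)"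
proof -
  \<comment> \<open>This radius puts both 0 and \<open>t\<close> in the interior of
    \<open>{-r..r}\<close>, so the derivative within the interval is a full derivative at
    \<open>t\<close>.\<close>
  define r where "r = \<bar>t\<bar> + 1"
  have "((\<lambda>t. LBINT s=ereal 0..ereal t. g s) has_vector_derivative g t) (at t within {- r..r})"
    by (rule interval_integral_FTC2) (auto simp: r_def intro: continuous_on_subset[OF assms])
  moreover have "at t within {- r..r} = at t"
    by (rule at_within_Icc_at) (auto simp: r_def)
  ultimately show ?thesis
    by (simp add: has_real_derivative_iff_has_vector_derivative zero_ereal_def)
qed

theorem theorem1p1:
  fixes T :: nat and c d :: real and g :: "real \<Rightarrow> real"
  assumes "T > 0" and "c > 0" and "d > 0"
    and "d ^ 3 < (3 / ((real T + 2) * (real T + 4) * (2 * real T + 2) ^ (T + 3))) * c ^ (T + 4)"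
    and "(3 / ((real T + 2) * (real T + 4) * (2 * real T + 2) ^ (T + 3))) * c ^ (T + 4)
         < 3 / ((real T + 2) * (real T + 4))"
    and "\<And>x. g x \<ge> 0" and "continuous_on UNIV g"
    and "\<exists>c\<^sub>0>0. \<forall>t::real. (LBINT s=0..ereal t. g s) < c\<^sub>0 * (1 + t ^ 2)"
    and "(LBINT \<xi>=0..ereal c. g \<xi>) / c ^ (T + 4)
         < (3 / ((real T + 4) * (real T + 2) * (2 * real T + 2) ^ (T + 3)))
           * ((LBINT \<xi>=0..ereal d. g \<xi>) / d ^ 3)"
  shows "\<forall>lam::real. ereal lam \<in> {lambda_lower T g d <..< lambda_upper T g c d}
           \<longrightarrow> (\<exists>u. is_positive_solution T g lam u)"
proof (intro allI impI)
  fix lam :: real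
  assume lam: "ereal lam \<in> {lambda_lower T g d <..< lambda_upper T g c d}"
  define G where "G t = (LBINT s=0..ereal t. g s)" for t :: real
  have G: "(G has_real_derivative g t) (at t)" for t
    unfolding G_def by (rule has_real_derivative_interval_integral) fact
  have G0: "G 0 = 0" by (simp add: G_def flip: zero_ereal_def)
  have G_nonneg: "G t \<ge> 0" if "t \<ge> 0" for t
  proof -
    have "G 0 \<le> G t"
      by (rule DERIV_nonneg_imp_nondecreasing[OF that]) (use G assms(6) in blast)
    then show ?thesis by (simp add: G0)
  qed
  \<comment> \<open>The strict inequality between the two quotients has a nonnegative left side,
    which excludes \<open>G d = 0\<close>.\<close>
  have "G d > 0"
  proof -
    have "0 \<le> G c / c ^ (T + 4)" using G_nonneg assms(2) by simp
    also have "\<dots> < (3 / ((real T + 4) * (real T + 2) * (2 * real T + 2) ^ (T + 3))) * (G d / d ^ 3)"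
      using assms(9) by (simp add: G_def)
    finally show ?thesis
      using G_nonneg[of d] \<open>d > 0\<close> by (cases "G d = 0") auto
  qed
  \<comment> \<open>Chaining the two bounds eliminates \<open>c\<close>, and
    \<open>(T+2) * (T+4) \<ge> 8\<close>.\<close>
  have "d < 1"
  proof -
    have "d ^ 3 < 3 / ((real T + 2) * (real T + 4))" using assms(4,5) by linarith
    also have "\<dots> \<le> 1"
      using mult_mono[of 2 "real T + 2" 4 "real T + 4"] by simp
    finally have "d ^ 3 < 1" .
    then show ?thesis using one_le_power[of d 3] by linarith
  qed
  have "d ^ 3 * (real T + 2) / (3 * real T * G d) < lam"
    using lam \<open>G d > 0\<close> \<open>T > 0\<close> by (simp add: lambda_lower_def G_def)
  then have lam_lower: "d ^ 3 * (real T + 2) / 3 < real T * (lam * G d)"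
    using \<open>G d > 0\<close> \<open>T > 0\<close> by (simp add: field_simps)
  \<comment> \<open>A nonpositive \<open>lam\<close> would make the right side nonpositive, while
    the left side is positive.\<close>
  then have "lam > 0"
    using \<open>G d > 0\<close> \<open>T > 0\<close> \<open>d > 0\<close>
    by (smt (verit) divide_nonneg_nonneg mult_nonneg_nonneg mult_nonneg_nonpos
        mult_nonpos_nonneg of_nat_0_le_iff zero_le_power)
  define F where "F t = lam * G t" for t
  have F: "(F has_real_derivative lam * g t) (at t)" for t
    unfolding F_def by (intro DERIV_cmult G)
  then have "continuous_on UNIV F"
    by (meson DERIV_isCont continuous_at_imp_continuous_on)
  obtain c0 where c0: "c0 > 0" "\<And>t. G t < c0 * (1 + t\<^sup>2)"
    using assms(8) by (auto simp: G_def)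
  have "F t \<le> lam * c0 * (1 + t\<^sup>2)" for t
    using c0(2)[of t] \<open>lam > 0\<close> unfolding F_def by (simp add: mult.assoc)
  then obtain u where u: "u \<in> dirichlet_space T"
      "\<And>v. v \<in> dirichlet_space T \<Longrightarrow> energy T F u \<le> energy T F v"
    using energy_attains_min[OF \<open>continuous_on UNIV F\<close>, of "lam * c0" T] c0(1) \<open>lam > 0\<close>
    by (metis mult_pos_pos)
  have "is_solution T g lam u"
    by (rule energy_minimizer_is_solution[OF u F])
  \<comment> \<open>The zero function has energy 0, whereas \<open>lam_lower\<close> says exactly
    that the plateau bound is negative.\<close>
  moreover have "\<not> (\<forall>k\<in>{0..T+1}. u k = 0)"
  proof
    assume "\<forall>k\<in>{0..T+1}. u k = 0"
    then have "energy T F u = (\<Sum>j=1..T+1. 0) + (\<Sum>j=1..T. 0)"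
      unfolding energy_def by (intro arg_cong2[where f = "(+)"] sum.cong) (auto simp: F_def G0)
    then have "energy T F u = 0"
      by simp
    moreover have "energy T F u \<le> energy T F (\<lambda>k\<in>{0..T+1}. if k \<in> {1..T} then d else 0)"
      by (rule u(2)) (auto simp: dirichlet_space_def)
    moreover have "\<dots> < 0"
      using energy_plateau_le[OF \<open>T > 0\<close> \<open>d > 0\<close> \<open>d < 1\<close>, of F] lam_lower by (simp add: F_def)
    ultimately show False by linarith
  qed
  ultimately show "\<exists>u. is_positive_solution T g lam u"
    using solution_positive_or_zero[of T g lam u] assms(6) \<open>lam > 0\<close> by auto
qed

end
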